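(* Let $A=\{a_1,\dots,a_r\}$, let $F$ be the free group on $A$, let $G=\langle A\mid R\rangle$ be a finite presentation of a quotient of $F$, and let $T$ be a geodesic combing in the Cayley graph $\Gamma(G)$ of $G$ with respect to $A$. Write $\mathbb{N}=\{2,3,4,\dots\}$. Assume: (1) there are non-decreasing functions $f,g\colon\mathbb{N}\to\mathbb{R}^+$ and a constant $c_0$ such that, for every sufficiently large real $c$, there is a constant $K_c$ with $$\sharp\{w\in A^*: |w|_A=n,\ |w|_G>c f(n)\}\le K_c\,\frac{(2r)^n}{g(n)^{c-c_0}}\quad\text{for all } n\in\mathbb{N};$$ (2) there are $k\in\mathbb{R}^+$ and a constant $C$ such that the Dehn function of the presentation satisfies $D(n)\le C n^k$ for all $n\in\mathbb{N}$, and there are $\alpha>0$ and $\delta>0$ such that $g(n)/n^\alpha\ge\delta$ for all $n\in\mathbb{N}$. Let $h\colon\mathbb{N}\to\mathbb{R}^+$ be any non-decreasing function satisfying $$2h\bigl(\lceil n/2\rceil\bigr)+f(n)^k\le h(n)$$ for all sufficiently large $n$. Then there is a constant $K$ such that $D_{\mathrm{osmean}}(n)\le K\,h(n)$ for all $n\in\mathbb{N}$, where $D_{\mathrm{osmean}}$ is the open spherical mean Dehn function of the presentation with respect to $T$.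
   Context: Let $A^*$ be the free monoid on $A\cup A^{-1}$ (possibly non-reduced words). Words $w\in A^*$ are identified with paths in the Cayley graph $\Gamma(G)$ starting at the identity vertex $e$ (backtrackings allowed). $|w|_A$ is the number of letters of $w$, and $|w|_G$ is the minimal number of letters of a word in $A^*$ representing the same element of $G$. If $w$ represents $1$ in $G$, $\operatorname{area}(w)$ is the minimal $m\ge 0$ such that in $F$ one can write $w=\prod_{i=1}^m f_i^{-1}r_i^{\epsilon_i}f_i$ with $f_i\in F$, $r_i\in R$, $\epsilon_i=\pm1$. The Dehn function is $D(n)=\max\{\operatorname{area}(w): w\in A^*,\ w=_G1,\ |w|_A\le n\}$. A combing in $\Gamma(G)$ is a set $T$ consisting of exactly one path $T[v]$ from $e$ to $v$ for every vertex $v$, with $T[e]$ the trivial path; it is geodesic if every $T[v]$ is a geodesic. For an arbitrary word $w\in A^*$, viewed as a path from $e$ to the vertex $v$ it represents, $\operatorname{area}(w)=\operatorname{area}\bigl(w\,T[v]^{-1}\bigr)$ (with $T[v]$ identified with the word it reads). The open spherical mean Dehn function is $$D_{\mathrm{osmean}}(n)=\frac{1}{(2r)^n}\sum_{w\in A^*,\ |w|_A=n}\operatorname{area}(w).$$ $\lceil\cdot\rceil$ is the usual ceiling function. *)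

theory Defs
  imports Complex_Main "HOL-Library.Cardinality" "HOL-Algebra.Generated_Groups"
begin

text \<open>
  The alphabet \<open>A\<close> is a finite type \<open>'a\<close>, so \<open>r = CARD('a)\<close>. The letter \<open>(a, True)\<close> stands for
  the generator \<open>a\<close> and \<open>(a, False)\<close> for its formal inverse; \<open>'a word\<close> is \<open>A\<^sup>*\<close>, the free monoid
  on \<open>A \<union> A\<^sup>-\<^sup>1\<close>, non-reduced words included.
\<close>

type_synonym 'a letter = "'a \<times> bool"
type_synonym 'a word = "'a letter list"

definition inv_letter :: "'a letter \<Rightarrow> 'a letter"
  where "inv_letter x = (fst x, \<not> snd x)"

definition inv_word :: "'a word \<Rightarrow> 'a word"
  where "inv_word w = rev (map inv_letter w)"

definition reduced :: "'a word \<Rightarrow> bool"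
  where "reduced w \<longleftrightarrow> successively (\<lambda>x y. y \<noteq> inv_letter x) w"

definition cancel_cons :: "'a letter \<Rightarrow> 'a word \<Rightarrow> 'a word"
  where "cancel_cons x w =
    (case w of [] \<Rightarrow> [x] | y # ys \<Rightarrow> if y = inv_letter x then ys else x # w)"

definition reduce :: "'a word \<Rightarrow> 'a word"
  where "reduce w = foldr cancel_cons w []"

definition free_group :: "'a word monoid"
  where "free_group = \<lparr>carrier = {w. reduced w}, mult = \<lambda>u v. reduce (u @ v), one = []\<rparr>"

definition relator_conj :: "'a word \<Rightarrow> 'a word \<Rightarrow> int \<Rightarrow> 'a word"
  where "relator_conj f r \<epsilon> =
    inv\<^bsub>free_group\<^esub> f \<otimes>\<^bsub>free_group\<^esub> (r [^]\<^bsub>free_group\<^esub> \<epsilon>) \<otimes>\<^bsub>free_group\<^esub> f"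

definition normal_closure :: "'a word set \<Rightarrow> 'a word set"
  where "normal_closure R =
    generate free_group {relator_conj f r 1 | f r. f \<in> carrier free_group \<and> r \<in> R}"

definition presented_group :: "'a word set \<Rightarrow> 'a word set monoid"
  where "presented_group R = free_group Mod normal_closure R"

text \<open>
  The element of \<open>G\<close> represented by a word, that is, the end vertex of the path from the identity
  vertex of the (labelled) Cayley graph that reads the word; see \<open>word_elem_Nil\<close> and
  \<open>word_elem_snoc\<close> below. Paths starting at the identity vertex are identified with words.
\<close>

definition word_elem :: "'a word set \<Rightarrow> 'a word \<Rightarrow> 'a word set"
  where "word_elem R w = normal_closure R #>\<^bsub>free_group\<^esub> reduce w"

definition group_length :: "'a word set \<Rightarrow> 'a word \<Rightarrow> nat"
  where "group_length R w = (LEAST n. \<exists>u. word_elem R u = word_elem R w \<and> length u = n)"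

text \<open>Meaningful only for words \<open>w\<close> that represent \<open>1\<close> in \<open>G\<close>.\<close>

definition area :: "'a word set \<Rightarrow> 'a word \<Rightarrow> nat"
  where "area R w = (LEAST m. \<exists>(f :: nat \<Rightarrow> 'a word) (r :: nat \<Rightarrow> 'a word) (\<epsilon> :: nat \<Rightarrow> int).
    (\<forall>i<m. f i \<in> carrier free_group \<and> r i \<in> R \<and> \<epsilon> i \<in> {1, -1}) \<and>
    reduce w = foldr (\<otimes>\<^bsub>free_group\<^esub>) (map (\<lambda>i. relator_conj (f i) (r i) (\<epsilon> i)) [0..<m])
      \<one>\<^bsub>free_group\<^esub>)"

definition dehn :: "('a::finite) word set \<Rightarrow> nat \<Rightarrow> nat"
  where "dehn R n =
    Max {area R w | w. word_elem R w = \<one>\<^bsub>presented_group R\<^esub> \<and> length w \<le> n}"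

definition combing :: "'a word set \<Rightarrow> ('a word set \<Rightarrow> 'a word) \<Rightarrow> bool"
  where "combing R T \<longleftrightarrow>
    (\<forall>v \<in> carrier (presented_group R). word_elem R (T v) = v) \<and> T \<one>\<^bsub>presented_group R\<^esub> = []"

definition geodesic :: "'a word set \<Rightarrow> 'a word \<Rightarrow> bool"
  where "geodesic R w \<longleftrightarrow> (\<forall>u. word_elem R u = word_elem R w \<longrightarrow> length w \<le> length u)"

definition geodesic_combing :: "'a word set \<Rightarrow> ('a word set \<Rightarrow> 'a word) \<Rightarrow> bool"
  where "geodesic_combing R T \<longleftrightarrow>
    combing R T \<and> (\<forall>v \<in> carrier (presented_group R). geodesic R (T v))"

definition open_area :: "'a word set \<Rightarrow> ('a word set \<Rightarrow> 'a word) \<Rightarrow> 'a word \<Rightarrow> nat"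
  where "open_area R T w = area R (w @ inv_word (T (word_elem R w)))"

definition D_osmean :: "('a::finite) word set \<Rightarrow> ('a word set \<Rightarrow> 'a word) \<Rightarrow> nat \<Rightarrow> real"
  where "D_osmean R T n =
    1 / real ((2 * CARD('a)) ^ n) * (\<Sum>w | length w = n. real (open_area R T w))"

lemma inv_letter_inv_letter [simp]: "inv_letter (inv_letter x) = x"
  by (simp add: inv_letter_def)

lemma inv_letter_neq [simp]: "inv_letter x \<noteq> x" "x \<noteq> inv_letter x"
  by (simp_all add: inv_letter_def prod_eq_iff)

lemma inv_letter_eq_iff [simp]: "inv_letter x = inv_letter y \<longleftrightarrow> x = y"
  by (metis inv_letter_inv_letter)

lemma reduced_cancel_cons: "reduced w \<Longrightarrow> reduced (cancel_cons x w)"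
  by (cases w) (auto simp: reduced_def cancel_cons_def successively_Cons)

lemma reduced_foldr: "reduced v \<Longrightarrow> reduced (foldr cancel_cons u v)"
  by (induction u) (auto intro: reduced_cancel_cons)

lemma reduced_Nil [simp]: "reduced []"
  by (simp add: reduced_def)

lemma reduced_reduce [simp]: "reduced (reduce w)"
  by (simp add: reduce_def reduced_foldr)

lemma cancel_cons_inv:
  assumes "reduced w"
  shows "cancel_cons x (cancel_cons (inv_letter x) w) = w"
proof (cases w)
  case (Cons y ys)
  then show ?thesis
    using assms by (cases ys) (auto simp: cancel_cons_def reduced_def)
qed (simp add: cancel_cons_def)

lemma foldr_reduce:
  assumes "reduced v"
  shows "foldr cancel_cons (reduce u) v = foldr cancel_cons u v"
proof (induction u)
  case (Cons x u)
  define p where "p = reduce u"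
  have p: "foldr cancel_cons p v = foldr cancel_cons u v"
    using Cons p_def by simp
  have "foldr cancel_cons (cancel_cons x p) v = cancel_cons x (foldr cancel_cons p v)"
  proof (cases p)
    case (Cons y ys)
    then have "cancel_cons x p = (if y = inv_letter x then ys else x # p)"
      by (simp add: cancel_cons_def)
    then show ?thesis
      using Cons by (simp add: cancel_cons_inv reduced_foldr assms)
  qed (simp add: cancel_cons_def)
  then show ?case
    using p by (simp add: reduce_def p_def)
qed (simp add: reduce_def)

lemma reduce_append: "reduce (u @ v) = foldr cancel_cons u (reduce v)"
  by (simp add: reduce_def)

lemma reduce_idem: "reduced w \<Longrightarrow> reduce w = w"
proof (induction w)
  case (Cons x w)
  then show ?case
    by (cases w) (auto simp: reduce_def reduced_def cancel_cons_def)
qed (simp add: reduce_def)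

lemma reduce_append_reduce [simp]:
  "reduce (reduce u @ v) = reduce (u @ v)" "reduce (u @ reduce v) = reduce (u @ v)"
  by (simp_all add: reduce_append foldr_reduce reduce_idem)

lemma reduce_inv_word: "reduce (inv_word w @ w) = []"
proof (induction w)
  case (Cons x w)
  have "reduce (inv_word (x # w) @ x # w)
      = foldr cancel_cons (inv_word w) (cancel_cons (inv_letter x) (cancel_cons x (reduce w)))"
    by (simp add: inv_word_def reduce_def)
  also have "\<dots> = reduce (inv_word w @ w)"
    using cancel_cons_inv[of "reduce w" "inv_letter x"] by (simp add: reduce_append)
  finally show ?case
    using Cons by simp
qed (simp add: inv_word_def reduce_def)

lemma group_free_group: "group free_group"
proof (rule groupI)
  fix x :: "'a word" assume "x \<in> carrier free_group"
  then show "\<exists>y\<in>carrier free_group. y \<otimes>\<^bsub>free_group\<^esub> x = \<one>\<^bsub>free_group\<^esub>"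
    by (intro bexI[of _ "reduce (inv_word x)"]) (auto simp: free_group_def reduce_inv_word)
qed (auto simp: free_group_def reduce_idem)

lemma normal_normal_closure:
  assumes "R \<subseteq> carrier free_group"
  shows "normal_closure R \<lhd> free_group"
proof -
  interpret F: group "free_group :: 'a word monoid" by (rule group_free_group)
  show ?thesis
    unfolding normal_closure_def
  proof (rule F.normal_generateI)
    show "{relator_conj f r 1 | f r. f \<in> carrier free_group \<and> r \<in> R} \<subseteq> carrier free_group"
      using assms by (auto simp: relator_conj_def)
  next
    fix h g :: "'a word"
    assume "h \<in> {relator_conj f r 1 | f r. f \<in> carrier free_group \<and> r \<in> R}"
      and g: "g \<in> carrier free_group"
    then obtain f r where fr: "f \<in> carrier free_group" "r \<in> R" "h = relator_conj f r 1"
      by auto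
    then have r: "r \<in> carrier free_group"
      using assms by auto
    have "g \<otimes>\<^bsub>free_group\<^esub> h \<otimes>\<^bsub>free_group\<^esub> inv\<^bsub>free_group\<^esub> g
        = relator_conj (f \<otimes>\<^bsub>free_group\<^esub> inv\<^bsub>free_group\<^esub> g) r 1"
      using fr(1) r g by (simp add: fr(3) relator_conj_def F.inv_mult_group F.m_assoc)
    then show "g \<otimes>\<^bsub>free_group\<^esub> h \<otimes>\<^bsub>free_group\<^esub> inv\<^bsub>free_group\<^esub> g
        \<in> {relator_conj f r 1 | f r. f \<in> carrier free_group \<and> r \<in> R}"
      using fr g by blast
  qed
qed

lemma group_presented_group:
  "R \<subseteq> carrier free_group \<Longrightarrow> group (presented_group R)"
  unfolding presented_group_def by (rule normal.factorgroup_is_group[OF normal_normal_closure])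

lemma word_elem_append:
  assumes "R \<subseteq> carrier free_group"
  shows "word_elem R (u @ v) = word_elem R u \<otimes>\<^bsub>presented_group R\<^esub> word_elem R v"
proof -
  interpret normal "normal_closure R" free_group
    by (rule normal_normal_closure[OF assms])
  have "reduce u \<in> carrier free_group" "reduce v \<in> carrier free_group"
    "reduce (u @ v) = reduce u \<otimes>\<^bsub>free_group\<^esub> reduce v"
    by (simp_all add: free_group_def)
  then show ?thesis
    by (simp add: word_elem_def presented_group_def FactGroup_def rcos_sum)
qed

lemma word_elem_Nil:
  assumes "R \<subseteq> carrier free_group"
  shows "word_elem R [] = \<one>\<^bsub>presented_group R\<^esub>"
proof -
  interpret normal "normal_closure R" free_group
    by (rule normal_normal_closure[OF assms])
  show ?thesis
    using coset_mult_one[OF subset]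
    by (simp add: word_elem_def presented_group_def FactGroup_def reduce_def free_group_def)
qed

lemma word_elem_snoc:
  "R \<subseteq> carrier free_group \<Longrightarrow>
    word_elem R (w @ [x]) = word_elem R w \<otimes>\<^bsub>presented_group R\<^esub> word_elem R [x]"
  by (rule word_elem_append)

lemma range_word_elem: "range (word_elem R) = carrier (presented_group R)"
proof -
  have "range (reduce :: 'a word \<Rightarrow> 'a word) = {w. reduced w}"
    by (auto simp: image_iff) (metis reduce_idem)
  then have "range (word_elem R) = (\<lambda>x. normal_closure R #>\<^bsub>free_group\<^esub> x) ` {w :: 'a word. reduced w}"
    unfolding word_elem_def by (metis image_image)
  also have "\<dots> = carrier (presented_group R)"
    unfolding presented_group_def FactGroup_def RCOSETS_def by (auto simp: free_group_def)
  finally show ?thesis .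
qed

end

theory Submission
  imports Defs
begin

text \<open>
  Cut a word of length \<open>n\<close> into two halves, \<open>w = uv\<close>. Filling the geodesic triangle
  \<open>T[u] T[v] T[w]\<^sup>-\<^sup>1\<close> together with the fillings of \<open>u\<close> and \<open>v\<close> fills \<open>w\<close>. If all three sides are
  at most \<open>c f(n)\<close>, the triangle has area \<open>O(f(n)\<^sup>k)\<close>. Otherwise its area is still \<open>O(n\<^sup>k)\<close>, and for
  large \<open>c\<close> the growth of \<open>g\<close> makes the proportion of such words \<open>O(n\<^sup>-\<^sup>k)\<close>. Hence
  \<open>D\<^sub>o\<^sub>s\<^sub>m\<^sub>e\<^sub>a\<^sub>n(n) \<le> D\<^sub>o\<^sub>s\<^sub>m\<^sub>e\<^sub>a\<^sub>n(\<lceil>n/2\<rceil>) + D\<^sub>o\<^sub>s\<^sub>m\<^sub>e\<^sub>a\<^sub>n(\<lfloor>n/2\<rfloor>) + O(f(n)\<^sup>k)\<close>, and up to a constant \<open>h\<close>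
  is a supersolution of this recursion.
\<close>

section \<open>Areas\<close>

lemma (in group) inv_mult_cancel:
  assumes "x \<in> carrier G" "y \<in> carrier G"
  shows "inv x \<otimes> (x \<otimes> y) = y" "x \<otimes> (inv x \<otimes> y) = y"
  using assms by (simp_all add: m_assoc[symmetric])

lemma reduce_carrier [simp]: "reduce w \<in> carrier free_group"
  by (simp add: free_group_def)

lemma reduce_append_mult: "reduce (u @ v) = reduce u \<otimes>\<^bsub>free_group\<^esub> reduce v"
  by (simp add: free_group_def)

lemma reduce_inv_word_inv: "reduce (inv_word w) = inv\<^bsub>free_group\<^esub> (reduce w)"
proof -
  interpret F: group "free_group :: 'a word monoid" by (rule group_free_group)
  have "reduce (inv_word w) \<otimes>\<^bsub>free_group\<^esub> reduce w = \<one>\<^bsub>free_group\<^esub>"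
    using reduce_inv_word[of w] by (simp add: reduce_append_mult) (simp add: free_group_def)
  then show ?thesis
    by (metis F.inv_equality reduce_carrier)
qed

text \<open>\<open>area\<close> indexes its factors by three functions on the naturals. A list of
  triples encodes the same data in a form suited to list induction, with the number of factors as an
  explicit parameter.\<close>

definition fillable :: "'a word set \<Rightarrow> nat \<Rightarrow> 'a word \<Rightarrow> bool"
  where "fillable R m x \<longleftrightarrow> (\<exists>L. length L = m \<and>
    (\<forall>(f, r, \<epsilon>)\<in>set L. f \<in> carrier free_group \<and> r \<in> R \<and> \<epsilon> \<in> {1, -1}) \<and>
    x = foldr (\<otimes>\<^bsub>free_group\<^esub>) (map (\<lambda>(f, r, \<epsilon>). relator_conj f r \<epsilon>) L) \<one>\<^bsub>free_group\<^esub>)"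

lemma fillable_indexed:
  "fillable R m x \<longleftrightarrow> (\<exists>(f :: nat \<Rightarrow> 'a word) (r :: nat \<Rightarrow> 'a word) (\<epsilon> :: nat \<Rightarrow> int).
    (\<forall>i<m. f i \<in> carrier free_group \<and> r i \<in> R \<and> \<epsilon> i \<in> {1, -1}) \<and>
    x = foldr (\<otimes>\<^bsub>free_group\<^esub>) (map (\<lambda>i. relator_conj (f i) (r i) (\<epsilon> i)) [0..<m])
      \<one>\<^bsub>free_group\<^esub>)" (is "_ \<longleftrightarrow> ?rhs")
proof
  assume "fillable R m x"
  then obtain L where L: "length L = m"
    "\<forall>(f, r, \<epsilon>)\<in>set L. f \<in> carrier free_group \<and> r \<in> R \<and> \<epsilon> \<in> {1, -1}"
    "x = foldr (\<otimes>\<^bsub>free_group\<^esub>) (map (\<lambda>(f, r, \<epsilon>). relator_conj f r \<epsilon>) L) \<one>\<^bsub>free_group\<^esub>"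
    by (auto simp: fillable_def)
  have "map (\<lambda>(f, r, \<epsilon>). relator_conj f r \<epsilon>) L
      = map (\<lambda>i. relator_conj (fst (L ! i)) (fst (snd (L ! i))) (snd (snd (L ! i)))) [0..<m]"
    using L(1) by (intro nth_equalityI) (auto simp: case_prod_beta)
  moreover have "\<forall>i<m. fst (L ! i) \<in> carrier free_group \<and> fst (snd (L ! i)) \<in> R
      \<and> snd (snd (L ! i)) \<in> {1, -1}"
    using L(1,2) nth_mem by (fastforce simp: case_prod_beta)
  ultimately show ?rhs
    using L(3) by (intro exI[of _ "\<lambda>i. fst (L ! i)"] exI[of _ "\<lambda>i. fst (snd (L ! i))"]
        exI[of _ "\<lambda>i. snd (snd (L ! i))"]) simp
next
  assume ?rhs
  then obtain f r \<epsilon> where *: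
    "\<forall>i<m. f i \<in> carrier free_group \<and> r i \<in> R \<and> \<epsilon> i \<in> {1, -1 :: int}"
    "x = foldr (\<otimes>\<^bsub>free_group\<^esub>) (map (\<lambda>i. relator_conj (f i) (r i) (\<epsilon> i)) [0..<m])
      \<one>\<^bsub>free_group\<^esub>"
    by blast
  then show "fillable R m x"
    unfolding fillable_def
    by (intro exI[of _ "map (\<lambda>i. (f i, r i, \<epsilon> i)) [0..<m]"]) (auto simp: comp_def)
qed

lemma area_eq_Least_fillable: "area R w = (LEAST m. fillable R m (reduce w))"
  by (simp add: area_def fillable_indexed)

lemma relator_conj_carrier:
  assumes "f \<in> carrier free_group" "r \<in> carrier free_group"
  shows "relator_conj f r \<epsilon> \<in> carrier free_group"
proof -
  interpret F: group "free_group :: 'a word monoid" by (rule group_free_group)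
  show ?thesis using assms by (simp add: relator_conj_def)
qed

section \<open>Calculus of products of conjugated relators\<close>

context
  fixes R :: "'a word set"
  assumes R_free: "R \<subseteq> carrier free_group"
begin

interpretation F: group "free_group :: 'a word monoid" by (rule group_free_group)

lemma fillable_0: "fillable R 0 \<one>\<^bsub>free_group\<^esub>"
  by (simp add: fillable_def)

lemma fillable_Suc:
  assumes "f \<in> carrier free_group" "r \<in> R" "\<epsilon> \<in> {1, -1}" "fillable R m x"
  shows "fillable R (Suc m) (relator_conj f r \<epsilon> \<otimes>\<^bsub>free_group\<^esub> x)"
proof -
  obtain L where "length L = m"
    "\<forall>(f, r, \<epsilon>)\<in>set L. f \<in> carrier free_group \<and> r \<in> R \<and> \<epsilon> \<in> {1, -1}"
    "x = foldr (\<otimes>\<^bsub>free_group\<^esub>) (map (\<lambda>(f, r, \<epsilon>). relator_conj f r \<epsilon>) L) \<one>\<^bsub>free_group\<^esub>"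
    using assms(4) by (auto simp: fillable_def)
  then show ?thesis
    using assms unfolding fillable_def by (intro exI[of _ "(f, r, \<epsilon>) # L"]) auto
qed

text \<open>Follows the right nesting of \<open>foldr\<close>: the leftmost factor is split off and
  the remaining product is again fillable, with one factor fewer.\<close>

lemma fillable_induct [consumes 1, case_names 0 Suc]:
  assumes "fillable R m x"
    and "P 0 \<one>\<^bsub>free_group\<^esub>"
    and "\<And>f r \<epsilon> m x. f \<in> carrier free_group \<Longrightarrow> r \<in> R \<Longrightarrow> \<epsilon> \<in> {1, -1} \<Longrightarrow> fillable R m x \<Longrightarrow>
      P m x \<Longrightarrow> P (Suc m) (relator_conj f r \<epsilon> \<otimes>\<^bsub>free_group\<^esub> x)"
  shows "P m x"
proof -
  obtain L where "length L = m"
    "\<forall>(f, r, \<epsilon>)\<in>set L. f \<in> carrier free_group \<and> r \<in> R \<and> \<epsilon> \<in> {1, -1}"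
    "x = foldr (\<otimes>\<^bsub>free_group\<^esub>) (map (\<lambda>(f, r, \<epsilon>). relator_conj f r \<epsilon>) L) \<one>\<^bsub>free_group\<^esub>"
    using assms(1) by (auto simp: fillable_def)
  then show ?thesis
  proof (induction L arbitrary: m x)
    case Nil
    then show ?case using assms(2) by simp
  next
    case (Cons t L)
    obtain f r \<epsilon> where t: "t = (f, r, \<epsilon>)" by (cases t) auto
    define y where
      "y = foldr (\<otimes>\<^bsub>free_group\<^esub>) (map (\<lambda>(f, r, \<epsilon>). relator_conj f r \<epsilon>) L) \<one>\<^bsub>free_group\<^esub>"
    have "fillable R (length L) y"
      using Cons.prems unfolding fillable_def y_def by (intro exI[of _ L]) auto
    moreover have "P (length L) y"
      using Cons by (auto simp: y_def)
    ultimately have "P (Suc (length L)) (relator_conj f r \<epsilon> \<otimes>\<^bsub>free_group\<^esub> y)"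
      using Cons.prems t by (intro assms(3)) auto
    then show ?case
      using Cons.prems by (simp add: t y_def)
  qed
qed

lemma fillable_carrier:
  assumes "fillable R m x"
  shows "x \<in> carrier free_group"
  using assms R_free
  by (induction rule: fillable_induct) (auto intro!: F.m_closed relator_conj_carrier)

lemma fillable_mult:
  assumes "fillable R m x" "fillable R n y"
  shows "fillable R (m + n) (x \<otimes>\<^bsub>free_group\<^esub> y)"
  using assms(1)
proof (induction rule: fillable_induct)
  case 0
  then show ?case using assms(2) by (simp add: fillable_carrier)
next
  case (Suc f r \<epsilon> m x)
  then have "relator_conj f r \<epsilon> \<in> carrier free_group" "x \<in> carrier free_group"
    using R_free by (auto intro: relator_conj_carrier fillable_carrier)
  then show ?case
    using Suc fillable_Suc[of f r \<epsilon> "m + n" "x \<otimes>\<^bsub>free_group\<^esub> y"] assms(2)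
    by (simp add: F.m_assoc fillable_carrier)
qed

text \<open>Conjugating f^-1 r f by t only replaces the conjugator f by f t^-1, so the number of
  factors is unchanged.\<close>

lemma fillable_conj:
  assumes "fillable R m x" "t \<in> carrier free_group"
  shows "fillable R m (t \<otimes>\<^bsub>free_group\<^esub> x \<otimes>\<^bsub>free_group\<^esub> inv\<^bsub>free_group\<^esub> t)"
  using assms(1)
proof (induction rule: fillable_induct)
  case 0
  then show ?case using assms(2) fillable_0 by simp
next
  case (Suc f r \<epsilon> m x)
  then have c: "r \<in> carrier free_group" "x \<in> carrier free_group"
    using R_free by (auto intro: fillable_carrier)
  have "t \<otimes>\<^bsub>free_group\<^esub> (relator_conj f r \<epsilon> \<otimes>\<^bsub>free_group\<^esub> x) \<otimes>\<^bsub>free_group\<^esub> inv\<^bsub>free_group\<^esub> t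
      = relator_conj (f \<otimes>\<^bsub>free_group\<^esub> inv\<^bsub>free_group\<^esub> t) r \<epsilon> \<otimes>\<^bsub>free_group\<^esub>
        (t \<otimes>\<^bsub>free_group\<^esub> x \<otimes>\<^bsub>free_group\<^esub> inv\<^bsub>free_group\<^esub> t)"
    using c Suc.hyps assms(2)
    by (simp add: relator_conj_def F.inv_mult_group F.m_assoc F.inv_mult_cancel)
  then show ?case
    using Suc assms(2) by (simp add: fillable_Suc)
qed

text \<open>The products of conjugated relators contain the generators of the normal closure and,
  through the exponent -1, their inverses, and they are closed under multiplication.\<close>

lemma fillable_of_normal_closure:
  assumes "x \<in> normal_closure R"
  shows "\<exists>m. fillable R m x"
  using assms unfolding normal_closure_def
proof (induction rule: generate.induct)
  case one
  then show ?case using fillable_0 by blast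
next
  case (incl h)
  then obtain f r where fr: "f \<in> carrier free_group" "r \<in> R" "h = relator_conj f r 1" by blast
  then have "h \<in> carrier free_group"
    using R_free by (auto intro: relator_conj_carrier)
  then show ?case
    using fillable_Suc[OF fr(1,2) _ fillable_0, of 1] fr(3) by auto
next
  case (inv h)
  then obtain f r where fr: "f \<in> carrier free_group" "r \<in> R" "h = relator_conj f r 1" by blast
  then have r: "r \<in> carrier free_group" using R_free by auto
  have "inv\<^bsub>free_group\<^esub> h = relator_conj f r (-1)"
    using fr r by (simp add: relator_conj_def F.inv_mult_group F.m_assoc F.int_pow_neg)
  moreover have "relator_conj f r (-1) \<in> carrier free_group"
    using fr r by (auto intro: relator_conj_carrier)
  ultimately show ?case
    using fillable_Suc[OF fr(1,2) _ fillable_0, of "-1"] by auto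
next
  case (eng h1 h2)
  then show ?case using fillable_mult by blast
qed

text \<open>Guarantees that the \<open>LEAST\<close> in \<open>area\<close> is attained: a word
  representing 1 reduces into the normal closure, so some filling exists.\<close>

lemma fillable_area:
  assumes "word_elem R w = \<one>\<^bsub>presented_group R\<^esub>"
  shows "fillable R (area R w) (reduce w)"
proof -
  interpret normal "normal_closure R" free_group
    by (rule normal_normal_closure[OF R_free])
  have "normal_closure R #>\<^bsub>free_group\<^esub> reduce w = normal_closure R"
    using assms by (simp add: word_elem_def presented_group_def FactGroup_def)
  then have "reduce w \<in> normal_closure R"
    using F.rcos_self[OF _ is_subgroup, of "reduce w"] by simp
  then show ?thesis
    unfolding area_eq_Least_fillable using fillable_of_normal_closure LeastI_ex by metis
qed

lemma area_le: "fillable R m (reduce w) \<Longrightarrow> area R w \<le> m"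
  unfolding area_eq_Least_fillable by (rule Least_le)

lemma area_append:
  assumes "word_elem R u = \<one>\<^bsub>presented_group R\<^esub>" "word_elem R v = \<one>\<^bsub>presented_group R\<^esub>"
  shows "area R (u @ v) \<le> area R u + area R v"
  using assms by (intro area_le) (simp add: reduce_append_mult fillable_mult fillable_area)

lemma area_conj:
  assumes "word_elem R w = \<one>\<^bsub>presented_group R\<^esub>"
  shows "area R (t @ w @ inv_word t) \<le> area R w"
proof (rule area_le)
  show "fillable R (area R w) (reduce (t @ w @ inv_word t))"
    using fillable_conj[OF fillable_area[OF assms], of "reduce t"]
    by (simp add: reduce_append_mult reduce_inv_word_inv F.m_assoc)
qed

lemma area_cong: "reduce u = reduce v \<Longrightarrow> area R u = area R v"
  by (simp add: area_def)

section \<open>Vertices of words and the triangle decomposition\<close>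

lemma word_elem_carrier [simp]: "word_elem R w \<in> carrier (presented_group R)"
  using range_word_elem by blast

lemma word_elem_inv_word: "word_elem R (inv_word w) = inv\<^bsub>presented_group R\<^esub> (word_elem R w)"
proof -
  interpret G: group "presented_group R" by (rule group_presented_group[OF R_free])
  have "word_elem R (inv_word w @ w) = word_elem R []"
    by (simp only: word_elem_def reduce_inv_word) (simp add: reduce_def)
  then have "word_elem R (inv_word w) \<otimes>\<^bsub>presented_group R\<^esub> word_elem R w = \<one>\<^bsub>presented_group R\<^esub>"
    by (simp add: word_elem_append[OF R_free] word_elem_Nil[OF R_free])
  then show ?thesis
    by (simp add: G.inv_equality)
qed

text \<open>The loop of \<open>u @ v\<close> is the loop of \<open>u\<close>, followed by the loop
  of \<open>v\<close> carried back along \<open>T[u]\<close>, followed by the triangle of combing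
  paths. The second claim says that this triangle closes up, which the Dehn function needs
  later.\<close>

lemma open_area_append:
  assumes "combing R T"
  shows "open_area R T (u @ v) \<le> open_area R T u + open_area R T v +
    area R (T (word_elem R u) @ T (word_elem R v) @ inv_word (T (word_elem R (u @ v))))"
    (is "_ \<le> _ + _ + area R ?tri")
    and "word_elem R (T (word_elem R u) @ T (word_elem R v) @ inv_word (T (word_elem R (u @ v))))
      = \<one>\<^bsub>presented_group R\<^esub>"
proof -
  interpret G: group "presented_group R" by (rule group_presented_group[OF R_free])
  define tu tv tw where "tu = T (word_elem R u)" and "tv = T (word_elem R v)"
    and "tw = T (word_elem R (u @ v))"
  have e: "word_elem R tu = word_elem R u" "word_elem R tv = word_elem R v"
    "word_elem R tw = word_elem R (u @ v)"
    using assms by (simp_all add: combing_def tu_def tv_def tw_def)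
  note we = word_elem_append[OF R_free] word_elem_inv_word
  have triv: "word_elem R (u @ inv_word tu) = \<one>\<^bsub>presented_group R\<^esub>"
    "word_elem R (v @ inv_word tv) = \<one>\<^bsub>presented_group R\<^esub>"
    by (simp_all add: we e)
  show tri: "word_elem R ?tri = \<one>\<^bsub>presented_group R\<^esub>"
    unfolding tu_def[symmetric] tv_def[symmetric] tw_def[symmetric]
    by (simp add: we e G.inv_mult_group G.m_assoc G.inv_mult_cancel)
  have conj: "word_elem R (tu @ (v @ inv_word tv) @ inv_word tu) = \<one>\<^bsub>presented_group R\<^esub>"
    using triv(2) by (simp add: we e G.m_assoc[symmetric])
  \<comment> \<open>An identity in the free group, valid by cancellation alone, so no relator is
    spent on it.\<close>
  have "reduce ((u @ v) @ inv_word tw) =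
      reduce ((u @ inv_word tu) @ (tu @ (v @ inv_word tv) @ inv_word tu) @ (tu @ tv @ inv_word tw))"
    by (simp add: reduce_append_mult reduce_inv_word_inv F.m_assoc F.inv_mult_cancel)
  then have "open_area R T (u @ v) =
      area R ((u @ inv_word tu) @ (tu @ (v @ inv_word tv) @ inv_word tu) @ (tu @ tv @ inv_word tw))"
    unfolding open_area_def tw_def[symmetric] by (rule area_cong)
  also have "\<dots> \<le> area R (u @ inv_word tu) +
      area R ((tu @ (v @ inv_word tv) @ inv_word tu) @ (tu @ tv @ inv_word tw))"
    using triv conj tri by (intro area_append) (simp_all only: tu_def tv_def tw_def
        word_elem_append[OF R_free, of "_ @ _ @ _"] G.one_closed G.l_one)
  also have "\<dots> \<le> area R (u @ inv_word tu) +
      (area R (tu @ (v @ inv_word tv) @ inv_word tu) + area R (tu @ tv @ inv_word tw))"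
    using conj tri unfolding tu_def tv_def tw_def by (intro add_left_mono area_append)
  \<comment> \<open>Carrying the loop of \<open>v\<close> along \<open>tu\<close> is a conjugation
    and costs no area.\<close>
  also have "\<dots> \<le> area R (u @ inv_word tu) + (area R (v @ inv_word tv) + area R (tu @ tv @ inv_word tw))"
    by (intro add_left_mono add_right_mono area_conj triv)
  finally show "open_area R T (u @ v) \<le> open_area R T u + open_area R T v + area R ?tri"
    by (simp add: open_area_def tu_def tv_def tw_def)
qed

end

section \<open>The Dehn function and geodesic triangles\<close>

lemma finite_words_length_le: "finite {w :: ('a::finite) word. length w \<le> n}"
  using finite_lists_length_le[of "UNIV :: 'a letter set" n] by simp

text \<open>Over a finite alphabet there are finitely many words of bounded length, so the
  \<open>Max\<close> in \<open>dehn\<close> ranges over a finite set.\<close>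

lemma area_le_dehn:
  assumes "word_elem R w = \<one>\<^bsub>presented_group R\<^esub>" "length w \<le> n"
  shows "area R w \<le> dehn R n"
  unfolding dehn_def
proof (rule Max_ge)
  have "{area R w | w. word_elem R w = \<one>\<^bsub>presented_group R\<^esub> \<and> length w \<le> n}
      \<subseteq> area R ` {w. length w \<le> n}" by blast
  then show "finite {area R w | w. word_elem R w = \<one>\<^bsub>presented_group R\<^esub> \<and> length w \<le> n}"
    by (rule finite_subset) (simp add: finite_words_length_le)
qed (use assms in blast)

lemma group_length_le_length: "group_length R w \<le> length w"
  unfolding group_length_def by (rule Least_le) blast

text \<open>The minimum defining \<open>group_length\<close> is attained by some word, and a
  geodesic to the same vertex cannot be longer.\<close>

lemma length_geodesic_combing:
  assumes "geodesic_combing R T"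
  shows "length (T (word_elem R w)) \<le> group_length R w"
proof -
  have v: "word_elem R w \<in> carrier (presented_group R)"
    using range_word_elem by blast
  have "\<exists>u. word_elem R u = word_elem R w \<and> length u = group_length R w"
    unfolding group_length_def by (rule LeastI_ex) blast
  then obtain u where u: "word_elem R u = word_elem R w" "length u = group_length R w"
    by blast
  have "geodesic R (T (word_elem R w))" "word_elem R (T (word_elem R w)) = word_elem R w"
    using assms v by (simp_all add: geodesic_combing_def combing_def)
  then show ?thesis
    using u by (metis geodesic_def)
qed

text \<open>The three group lengths bound the perimeter of the triangle, since inverting a path
  preserves its length.\<close>

lemma open_area_append_le_dehn:
  assumes "R \<subseteq> carrier free_group" "geodesic_combing R T"
    and "group_length R u + group_length R v + group_length R (u @ v) \<le> N"
  shows "open_area R T (u @ v) \<le> open_area R T u + open_area R T v + dehn R N"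
proof -
  have T: "combing R T" using assms(2) by (simp add: geodesic_combing_def)
  let ?tri = "T (word_elem R u) @ T (word_elem R v) @ inv_word (T (word_elem R (u @ v)))"
  have "length ?tri \<le> N"
    using length_geodesic_combing[OF assms(2), of u] length_geodesic_combing[OF assms(2), of v]
      length_geodesic_combing[OF assms(2), of "u @ v"] assms(3)
    by (simp add: inv_word_def)
  then have "area R ?tri \<le> dehn R N"
    by (intro area_le_dehn open_area_append(2)[OF assms(1) T])
  then show ?thesis
    using open_area_append(1)[OF assms(1) T, of u v] by linarith
qed

section \<open>Spherical means\<close>

text \<open>Expectation for a uniformly random word of length \<open>n\<close>. Applied to indicator
  functions it turns word counts into probabilities.\<close>

definition word_mean :: "nat \<Rightarrow> (('a::finite) word \<Rightarrow> real) \<Rightarrow> real"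
  where "word_mean n F = (\<Sum>w | length w = n. F w) / real ((2 * CARD('a)) ^ n)"

lemma finite_words: "finite {w :: ('a::finite) word. length w = n}"
  by (rule finite_subset[OF _ finite_words_length_le[of n]]) auto

lemma card_words: "card {w :: ('a::finite) word. length w = n} = (2 * CARD('a)) ^ n"
  using card_lists_length_eq[of "UNIV :: 'a letter set" n]
  by (simp add: card_cartesian_product[of UNIV UNIV, simplified] mult.commute)

lemma word_mean_const: "word_mean n (\<lambda>_ :: ('a::finite) word. c) = c"
  unfolding word_mean_def by (simp add: card_words del: of_nat_power)

lemma word_mean_add: "word_mean n (\<lambda>w. F w + H w) = word_mean n F + word_mean n H"
  by (simp add: word_mean_def sum.distrib add_divide_distrib)

lemma word_mean_mult: "word_mean n (\<lambda>w. c * F w) = c * word_mean n F"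
  by (simp add: word_mean_def sum_distrib_left)

lemma word_mean_mono: "(\<And>w. length w = n \<Longrightarrow> F w \<le> H w) \<Longrightarrow> word_mean n F \<le> word_mean n H"
  unfolding word_mean_def by (intro divide_right_mono sum_mono) auto

text \<open>Cutting after \<open>m\<close> letters is a bijection from words of length
  \<open>m + n\<close> to pairs of words.\<close>

lemma sum_words_append:
  fixes F :: "('a::finite) word \<Rightarrow> 'b::comm_monoid_add"
  shows "(\<Sum>w | length w = m + n. F w) = (\<Sum>u | length u = m. \<Sum>v | length v = n. F (u @ v))"
proof -
  have "(\<Sum>(u, v) \<in> {u. length u = m} \<times> {v. length v = n}. F (u @ v)) = (\<Sum>w | length w = m + n. F w)"
    by (rule sum.reindex_bij_witness[of _ "\<lambda>w. (take m w, drop m w)" "\<lambda>(u, v). u @ v"]) auto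
  then show ?thesis
    by (simp add: sum.cartesian_product)
qed

text \<open>A prefix of a uniformly random word is uniformly random: every prefix has the same
  number of extensions.\<close>

lemma word_mean_take: "word_mean (m + n) (\<lambda>w. F (take m w)) = word_mean m F"
  unfolding word_mean_def sum_words_append
  by (simp add: card_words power_add flip: sum_distrib_left)

lemma word_mean_drop: "word_mean (m + n) (\<lambda>w. F (drop m w)) = word_mean n F"
  unfolding word_mean_def sum_words_append
  by (simp add: card_words power_add)

lemma D_osmean_eq_word_mean: "D_osmean R T n = word_mean n (\<lambda>w. real (open_area R T w))"
  by (simp add: D_osmean_def word_mean_def)

lemma word_mean_of_bool:
  "word_mean n (\<lambda>w :: ('a::finite) word. of_bool (P w)) =
    real (card {w :: 'a word. length w = n \<and> P w}) / real ((2 * CARD('a)) ^ n)"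
proof -
  have "(\<Sum>w :: 'a word | length w = n. of_bool (P w)) = real (card {w :: 'a word. length w = n \<and> P w})"
    using finite_words[where ?'a = 'a, of n] by (simp add: of_bool_def sum.If_cases Int_def)
  then show ?thesis by (simp add: word_mean_def)
qed

section \<open>The recursion\<close>

lemma nat_ceiling_half: "nat \<lceil>real n / 2\<rceil> = n - n div 2"
  by linarith

text \<open>Strong induction: a sufficiently large multiple of \<open>h\<close> dominates the
  finitely many initial values and satisfies the reverse recursion afterwards. Monotonicity of
  \<open>h\<close> allows the smaller half to be treated like the larger one.\<close>

lemma halving_recursion_bound:
  fixes a h b :: "nat \<Rightarrow> real"
  assumes a_rec: "\<And>n. n \<ge> 4 \<Longrightarrow> a n \<le> a (n - n div 2) + a (n div 2) + B * b n"
    and b_nonneg: "\<And>n. b n \<ge> 0"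
    and h_pos: "\<And>n. n \<ge> 2 \<Longrightarrow> h n > 0"
    and h_mono: "mono_on {2..} h"
    and h_rec: "\<forall>\<^sub>F n in sequentially. 2 * h (n - n div 2) + b n \<le> h n"
  shows "\<exists>K. \<forall>n\<ge>2. a n \<le> K * h n"
proof -
  obtain N where N: "\<And>n. n \<ge> N \<Longrightarrow> 2 * h (n - n div 2) + b n \<le> h n"
    using h_rec by (auto simp: eventually_sequentially)
  define S where "S = (\<Sum>n<N + 4. \<bar>a n\<bar>)"
  \<comment> \<open>The first summand absorbs the term \<open>B * b n\<close>. The second covers the
    initial values, because \<open>h\<close> is at least \<open>h 2\<close> there.\<close>
  define K where "K = \<bar>B\<bar> + S / h 2"
  have "S \<ge> 0" by (simp add: S_def sum_nonneg)
  then have K: "K \<ge> \<bar>B\<bar>" "K \<ge> S / h 2" "K \<ge> 0"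
    using h_pos[of 2] by (simp_all add: K_def)
  have "a n \<le> K * h n" if "n \<ge> 2" for n
    using that
  proof (induction n rule: less_induct)
    case (less n)
    show ?case
    \<comment> \<open>From \<open>N + 4\<close> on, both recursions apply and both halves are at
      least 2, as the induction hypothesis requires.\<close>
    proof (cases "n < N + 4")
      case True
      have "a n \<le> \<bar>a n\<bar>" by simp
      also have "\<dots> \<le> S"
        unfolding S_def using True by (intro member_le_sum) auto
      also have "\<dots> = S / h 2 * h 2"
        using h_pos[of 2] by simp
      also have "\<dots> \<le> K * h n"
        using K \<open>S \<ge> 0\<close> h_pos[of 2] monotone_onD[OF h_mono, of 2 n] less.prems
        by (intro mult_mono) auto
      finally show ?thesis .
    next
      case False
      then have n: "n \<ge> 4" "n \<ge> N" by auto
      have "h (n div 2) \<le> h (n - n div 2)"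
        using n by (intro monotone_onD[OF h_mono]) auto
      then have "K * h (n div 2) \<le> K * h (n - n div 2)"
        using K by (intro mult_left_mono)
      moreover have "a (n - n div 2) \<le> K * h (n - n div 2)" "a (n div 2) \<le> K * h (n div 2)"
        using n by (auto intro!: less.IH)
      moreover have "B * b n \<le> K * b n"
        using K b_nonneg by (intro mult_right_mono) auto
      moreover have "K * (2 * h (n - n div 2) + b n) \<le> K * h n"
        using K N[OF n(2)] by (intro mult_left_mono)
      ultimately show ?thesis
        using a_rec[OF n(1)] by (simp add: algebra_simps)
    qed
  qed
  then show ?thesis by blast
qed

text \<open>The first part of the constant comes from triangles with sides at most
  \<open>c * f n\<close>. The second is the worst-case triangle area times the probability,
  controlled by \<open>P\<close>, that some side is longer.\<close>

lemma D_osmean_halving: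
  fixes R :: "('a::finite) word set"
  assumes R_free: "R \<subseteq> carrier free_group"
    and T: "geodesic_combing R T"
    and f_pos: "\<And>n. n \<ge> 2 \<Longrightarrow> f n > 0"
    and f_mono: "mono_on {2..} f"
    and dehn_bound: "\<And>n. n \<ge> 2 \<Longrightarrow> real (dehn R n) \<le> C * real n powr k"
    and k_pos: "k > 0"
    and c: "3 * c * f 2 \<ge> 2"
    and long: "\<And>n. n \<ge> 2 \<Longrightarrow>
      word_mean n (\<lambda>w :: 'a word. of_bool (real (group_length R w) > c * f n)) \<le> P / real n powr k"
    and n: "n \<ge> 4"
  shows "D_osmean R T n \<le> D_osmean R T (n - n div 2) + D_osmean R T (n div 2) +
    (C * (3 * c) powr k + 3 * C * P * 8 powr k / f 2 powr k) * f n powr k"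
proof -
  define m l where "m = n - n div 2" and "l = n div 2"
  \<comment> \<open>The hypotheses apply only from 2 on, whence \<open>n \<ge> 4\<close>. Since
    rounding leaves each half at least \<open>n / 4\<close>, tail bounds at \<open>m\<close> and
    \<open>l\<close> can be stated in terms of \<open>n\<close>.\<close>
  have ml: "n = m + l" "m \<ge> 2" "l \<ge> 2" "n \<le> 4 * m" "n \<le> 4 * l"
    using n by (auto simp: m_def l_def)
  \<comment> \<open>Signs of \<open>C\<close> and \<open>P\<close> are not assumed; they follow
    because areas and probabilities are nonnegative.\<close>
  have "0 \<le> C * 2 powr k"
    using order_trans[OF of_nat_0_le_iff dehn_bound[of 2]] by simp
  then have C: "C \<ge> 0"
    by (simp add: zero_le_mult_iff)
  have P: "P \<ge> 0"
  proof -
    have "0 \<le> word_mean 2 (\<lambda>w :: 'a word. of_bool (real (group_length R w) > c * f 2))"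
      by (simp add: word_mean_of_bool)
    also have "\<dots> \<le> P / 2 powr k" using long[of 2] by simp
    finally show ?thesis by (simp add: zero_le_divide_iff)
  qed
  have c_pos: "c > 0"
  proof -
    have "0 < c * f 2" using c by simp
    then show ?thesis using f_pos[of 2] by (simp add: zero_less_mult_iff)
  qed
  have f2n: "f 2 \<le> f n" "f m \<le> f n" "f l \<le> f n"
    using ml n by (auto intro!: monotone_onD[OF f_mono])
  have fn: "f n > 0" using f_pos n by simp
  \<comment> \<open>A perimeter is an integer, so rounding down loses nothing. The assumption on
    \<open>c\<close> gives \<open>M \<ge> 2\<close>, the range of the Dehn bound.\<close>
  define M where "M = nat \<lfloor>3 * c * f n\<rfloor>"
  have cfn: "3 * c * f n \<ge> 2"
    using c mult_left_mono[OF f2n(1), of "3 * c"] c_pos by linarith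
  then have M: "M \<ge> 2" "real M \<le> 3 * c * f n"
    unfolding M_def by linarith+
  define X where "X i w = (of_bool (real (group_length R w) > c * f i) :: real)"
    for i and w :: "'a word"
  \<comment> \<open>Triangle area bounds for short sides and for arbitrary sides. In the latter case
    the perimeter is at most \<open>m + l + n\<close>, which is \<open>2 * n\<close>.\<close>
  define good bad where "good = C * (3 * c) powr k * f n powr k" and "bad = C * real (2 * n) powr k"
  have bad_nonneg: "bad \<ge> 0" and good_nonneg: "good \<ge> 0"
    using C by (simp_all add: bad_def good_def)
  have dM: "real (dehn R M) \<le> good"
  proof -
    have "real (dehn R M) \<le> C * real M powr k" using dehn_bound M by simp
    also have "\<dots> \<le> C * (3 * c * f n) powr k"
      using C M k_pos by (intro mult_left_mono powr_mono2) auto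
    also have "\<dots> = good"
      using c_pos fn by (simp add: good_def powr_mult)
    finally show ?thesis .
  qed
  have dn: "real (dehn R (2 * n)) \<le> bad"
    using dehn_bound[of "2 * n"] n by (simp add: bad_def)
  \<comment> \<open>A union bound: as soon as one side is long, the sum of the three indicators is
    at least 1 and pays for the worst-case area.\<close>
  have pointwise: "real (open_area R T w) \<le> real (open_area R T (take m w))
      + real (open_area R T (drop m w))
      + (good + bad * (X m (take m w) + X l (drop m w) + X n w))" if w: "length w = n" for w :: "'a word"
  proof -
    define u v where "u = take m w" and "v = drop m w"
    have uv: "u @ v = w" "length u = m" "length v = l"
      using w ml by (auto simp: u_def v_def)
    show ?thesis
    proof (cases "X m u = 0 \<and> X l v = 0 \<and> X n w = 0")
      case True
      then have "real (group_length R u) \<le> c * f m" "real (group_length R v) \<le> c * f l"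
        "real (group_length R w) \<le> c * f n"
        by (auto simp: X_def not_less)
      moreover have "c * f m \<le> c * f n" "c * f l \<le> c * f n"
        using c_pos f2n by simp_all
      ultimately have "real (group_length R u + group_length R v + group_length R w) \<le> 3 * c * f n"
        by simp
      then have "group_length R u + group_length R v + group_length R (u @ v) \<le> M"
        unfolding M_def uv by linarith
      then have "open_area R T w \<le> open_area R T u + open_area R T v + dehn R M"
        using open_area_append_le_dehn[OF R_free T] uv by metis
      then have "real (open_area R T w) \<le> real (open_area R T u) + real (open_area R T v) + good"
        using dM by linarith
      then show ?thesis
        using True by (simp add: u_def v_def)
    next
      case False
      then have "X m u + X l v + X n w \<ge> 1"
        by (auto simp: X_def)
      then have "bad * 1 \<le> bad * (X m u + X l v + X n w)"
        using bad_nonneg by (intro mult_left_mono)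
      moreover have "group_length R u + group_length R v + group_length R (u @ v) \<le> 2 * n"
        using group_length_le_length[of R u] group_length_le_length[of R v]
          group_length_le_length[of R w] uv w ml by simp
      then have "open_area R T w \<le> open_area R T u + open_area R T v + dehn R (2 * n)"
        using open_area_append_le_dehn[OF R_free T] uv by metis
      ultimately show ?thesis
        using dn good_nonneg by (simp add: u_def v_def)
    qed
  qed
  have meanX: "word_mean i (X i) \<le> P * 4 powr k / real n powr k" if "i \<ge> 2" "n \<le> 4 * i" for i
  proof -
    have "word_mean i (X i) \<le> P / real i powr k"
      using long[OF that(1)] unfolding X_def .
    also have "\<dots> = P * 4 powr k / real (4 * i) powr k"
      using that by (simp add: powr_mult)
    also have "\<dots> \<le> P * 4 powr k / real n powr k"
      using that n P k_pos by (intro divide_left_mono powr_mono2) auto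
    finally show ?thesis .
  qed
  have "D_osmean R T n \<le> word_mean n (\<lambda>w :: 'a word. real (open_area R T (take m w))
      + real (open_area R T (drop m w)) + (good + bad * (X m (take m w) + X l (drop m w) + X n w)))"
    unfolding D_osmean_eq_word_mean by (rule word_mean_mono[OF pointwise])
  \<comment> \<open>Linearity of the mean, together with the uniform distribution of both
    halves.\<close>
  also have "\<dots> = D_osmean R T m + D_osmean R T l +
      (good + bad * (word_mean m (X m) + word_mean l (X l) + word_mean n (X n)))"
    unfolding word_mean_add word_mean_mult word_mean_const D_osmean_eq_word_mean ml(1)
      word_mean_take[of m l "\<lambda>w. real (open_area R T w)"]
      word_mean_drop[of m l "\<lambda>w. real (open_area R T w)"]
      word_mean_take[of m l "X m"] word_mean_drop[of m l "X l"] ..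
  also have "\<dots> \<le> D_osmean R T m + D_osmean R T l + (good + bad * (3 * (P * 4 powr k / real n powr k)))"
    using meanX[of m] meanX[of l] meanX[of n] ml n bad_nonneg
    by (intro add_left_mono mult_left_mono) auto
  \<comment> \<open>The powers of \<open>n\<close> cancel, leaving a constant: the factor 2 from the
    perimeter and 4 from the halves combine to 8.\<close>
  also have "bad * (3 * (P * 4 powr k / real n powr k)) = 3 * C * P * 8 powr k"
    using n powr_mult[of 2 4 k] by (simp add: bad_def powr_mult)
  \<comment> \<open>A constant is absorbed into a multiple of \<open>f n powr k\<close>, since
    \<open>f n\<close> stays above \<open>f 2 > 0\<close>.\<close>
  also have "3 * C * P * 8 powr k \<le> 3 * C * P * 8 powr k / f 2 powr k * f n powr k"
  proof -
    have "f 2 powr k \<le> f n powr k"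
      using f2n f_pos[of 2] k_pos by (intro powr_mono2) auto
    then have "1 \<le> f n powr k / f 2 powr k"
      using f_pos[of 2] by simp
    then have "3 * C * P * 8 powr k * 1 \<le> 3 * C * P * 8 powr k * (f n powr k / f 2 powr k)"
      using C P by (intro mult_left_mono) auto
    then show ?thesis by simp
  qed
  finally show ?thesis
    by (simp add: good_def m_def l_def algebra_simps)
qed

section \<open>Choice of the length threshold and conclusion\<close>

theorem theorem2p5:
  fixes R :: "('a::finite) word set"
    and T :: "'a word set \<Rightarrow> 'a word"
    and f g h :: "nat \<Rightarrow> real"
    and c\<^sub>0 k C \<alpha> \<delta> :: real
  assumes R_finite: "finite R"
    and R_free: "R \<subseteq> carrier free_group"
    and T: "geodesic_combing R T"
    and f_pos: "\<And>n. n \<ge> 2 \<Longrightarrow> f n > 0"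
    and f_mono: "mono_on {2..} f"
    and g_pos: "\<And>n. n \<ge> 2 \<Longrightarrow> g n > 0"
    and g_mono: "mono_on {2..} g"
    and tail: "\<forall>\<^sub>F c in at_top. \<exists>K\<^sub>c. \<forall>n\<ge>2.
      real (card {w :: 'a word. length w = n \<and> real (group_length R w) > c * f n})
        \<le> K\<^sub>c * (real ((2 * CARD('a)) ^ n) / g n powr (c - c\<^sub>0))"
    and k_pos: "k > 0"
    and dehn_bound: "\<And>n. n \<ge> 2 \<Longrightarrow> real (dehn R n) \<le> C * real n powr k"
    and \<alpha>_pos: "\<alpha> > 0"
    and \<delta>_pos: "\<delta> > 0"
    and g_growth: "\<And>n. n \<ge> 2 \<Longrightarrow> g n / real n powr \<alpha> \<ge> \<delta>"
    and h_pos: "\<And>n. n \<ge> 2 \<Longrightarrow> h n > 0"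
    and h_mono: "mono_on {2..} h"
    and h_rec: "\<forall>\<^sub>F n in sequentially.
      2 * h (nat \<lceil>real n / 2\<rceil>) + f n powr k \<le> h n"
  shows "\<exists>K :: real. \<forall>n\<ge>2. D_osmean R T n \<le> K * h n"
proof -
  have "\<forall>\<^sub>F c in at_top. c \<ge> 2 / (3 * f 2) \<and> c \<ge> c\<^sub>0 + k / \<alpha>"
    by (intro eventually_conj eventually_ge_at_top)
  \<comment> \<open>The first bound on \<open>c\<close> lifts the perimeter threshold to 2. The
    second makes the tail exponent so large that \<open>g n powr (c - c\<^sub>0)\<close> grows at
    least like \<open>n powr k\<close>, which cancels the Dehn bound.\<close>
  from eventually_conj[OF this tail] obtain c K\<^sub>c where c: "c \<ge> 2 / (3 * f 2)" "c \<ge> c\<^sub>0 + k / \<alpha>"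
    and Kc: "\<And>n. n \<ge> 2 \<Longrightarrow>
      real (card {w :: 'a word. length w = n \<and> real (group_length R w) > c * f n})
        \<le> K\<^sub>c * (real ((2 * CARD('a)) ^ n) / g n powr (c - c\<^sub>0))"
    unfolding eventually_at_top_linorder by blast
  define p where "p = c - c\<^sub>0"
  have "p \<ge> k / \<alpha>" using c(2) by (simp add: p_def)
  moreover have "k / \<alpha> \<ge> 0"
    using \<alpha>_pos k_pos by simp
  ultimately have p: "p \<ge> 0" by linarith
  have ap: "\<alpha> * p \<ge> k"
    using \<open>p \<ge> k / \<alpha>\<close> \<alpha>_pos by (simp add: field_simps)
  have c_f2: "3 * c * f 2 \<ge> 2"
    using c(1) f_pos[of 2] by (simp add: field_simps)
  \<comment> \<open>The absolute value is taken because \<open>K\<^sub>c\<close> may have either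
    sign; enlarging the denominator to \<open>g n powr p\<close> then goes the right way.\<close>
  define P where "P = \<bar>K\<^sub>c\<bar> / \<delta> powr p"
  have long: "word_mean n (\<lambda>w :: 'a word. of_bool (real (group_length R w) > c * f n))
      \<le> P / real n powr k" if n: "n \<ge> 2" for n
  proof -
    have "\<delta> * real n powr \<alpha> \<le> g n"
      using g_growth[OF n] n by (simp add: field_simps)
    then have "(\<delta> * real n powr \<alpha>) powr p \<le> g n powr p"
      using \<delta>_pos p by (intro powr_mono2) auto
    moreover have "\<delta> powr p * real n powr k \<le> \<delta> powr p * real n powr (\<alpha> * p)"
      using n ap by (intro mult_left_mono powr_mono) auto
    \<comment> \<open>Combines \<delta> n^\<alpha> \<le> g(n), raised to the power \<open>p\<close>,
      with \<alpha> p \<ge> k.\<close>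
    ultimately have g: "\<delta> powr p * real n powr k \<le> g n powr p"
      using \<delta>_pos by (simp only: powr_mult powr_powr powr_ge_zero)
    have "word_mean n (\<lambda>w :: 'a word. of_bool (real (group_length R w) > c * f n))
        \<le> K\<^sub>c * (real ((2 * CARD('a)) ^ n) / g n powr p) / real ((2 * CARD('a)) ^ n)"
      unfolding word_mean_of_bool p_def by (intro divide_right_mono Kc n) auto
    also have "\<dots> = K\<^sub>c / g n powr p"
      by simp
    also have "\<dots> \<le> \<bar>K\<^sub>c\<bar> / g n powr p"
      by (intro divide_right_mono) auto
    also have "\<dots> \<le> \<bar>K\<^sub>c\<bar> / (\<delta> powr p * real n powr k)"
      using g \<delta>_pos n g_pos[OF n] by (intro divide_left_mono) auto
    finally show ?thesis
      by (simp add: P_def)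
  qed
  show ?thesis
  proof (rule halving_recursion_bound[where b = "\<lambda>n. f n powr k"])
    show "\<forall>\<^sub>F n in sequentially. 2 * h (n - n div 2) + f n powr k \<le> h n"
      using h_rec unfolding nat_ceiling_half .
  qed (use D_osmean_halving[OF R_free T f_pos f_mono dehn_bound k_pos c_f2 long] h_pos h_mono
      in auto)
qed

end
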